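(* Let $\Gamma$ be a finite, undirected, connected graph without loops or multiple edges, with vertex set $X$, and let $x\in X$. Let $T=T(x)$ be the subconstituent algebra and $Q=Q(x)\subseteq T$ the quantum adjacency algebra of $\Gamma$ with respect to $x$. For irreducible $T$-modules $U,W$ the following are equivalent: (i) the $Q$-modules $U,W$ are isomorphic; (ii) the $T$-modules $U,W$ are quasi-isomorphic.
   Context: $\mathrm{Mat}_X(\mathbb{C})$ is the $\mathbb{C}$-algebra of matrices with rows and columns indexed by $X$, acting by left multiplication on $V=\mathbb{C}^X$ (column vectors indexed by $X$). Subalgebras contain the identity $I$. Let $\partial$ be the path-length distance of $\Gamma$, $A\in\mathrm{Mat}_X(\mathbb{C})$ the adjacency matrix, and $D=\max\{\partial(x,y): y\in X\}$. For $0\le i\le D$, $E_i^*$ is the diagonal matrix with $(y,y)$-entry $1$ if $\partial(x,y)=i$ and $0$ otherwise; $E_i^*=0$ for integers $i$ outside $[0,D]$. $T=T(x)$ is the subalgebra of $\mathrm{Mat}_X(\mathbb{C})$ generated by $A$ and $E_0^*,\dots,E_D^*$ (the subconstituent algebra). Put $L=\sum_{i=1}^{D}E_{i-1}^*AE_i^*$, $F=\sum_{i=0}^{D}E_i^*AE_i^*$, $R=\sum_{i=0}^{D-1}E_{i+1}^*AE_i^*$. $Q=Q(x)$ is the subalgebra of $T$ generated by $L,F,R$ (the quantum adjacency algebra). For a subalgebra $S$ of $\mathrm{Mat}_X(\mathbb{C})$, an $S$-module is a subspace $W\subseteq V$ with $SW\subseteq W$; it is irreducible if $W\ne 0$ and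 it contains no $S$-module other than $0$ and $W$. An isomorphism of $S$-modules $U\to W$ is a vector space isomorphism $\sigma$ with $\sigma s=s\sigma$ on $U$ for all $s\in S$. Every $T$-module is a $Q$-module by restriction. The endpoint of an irreducible $T$-module $W$ is $r(W)=\min\{i: 0\le i\le D,\ E_i^*W\ne 0\}$. For irreducible $T$-modules $U,W$, a quasi-isomorphism of $T$-modules from $U$ to $W$ is a $\mathbb{C}$-linear bijection $\sigma:U\to W$ such that, on $U$, $\sigma L=L\sigma$, $\sigma F=F\sigma$, $\sigma R=R\sigma$, and $\sigma E_i^*=E_{i+n}^*\sigma$ for all $i\in\mathbb{Z}$, where $n=r(W)-r(U)$. $U$ and $W$ are quasi-isomorphic if such a $\sigma$ exists. *)

theory Defs
  imports
    "HOL-Analysis.Analysis"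
    "Graph_Theory.Pair_Digraph"
    "Graph_Theory.Digraph_Component"
begin

text \<open>
  A finite simple graph is a \<open>pair_graph\<close>: a finite symmetric loop-free digraph whose arcs are
  ordered pairs of vertices. Its vertex set will be all of the finite type \<open>'v\<close>, which also
  indexes vectors and matrices, so that \<open>complex ^ 'v\<close> is the standard module.
  Scalar multiplication of vectors is \<open>(*s)\<close>, and \<open>vec.subspace\<close> means \<^emph>\<open>complex\<close> subspace.
\<close>

section \<open>Matrix algebras and their modules\<close>

definition mat_subalgebra :: "(complex ^ 'v ^ 'v) set \<Rightarrow> bool" where
  "mat_subalgebra S \<longleftrightarrow>
     mat 1 \<in> S \<and>
     (\<forall>M\<in>S. \<forall>N\<in>S. M + N \<in> S) \<and>
     (\<forall>c. \<forall>M\<in>S. map_matrix ((*) c) M \<in> S) \<and>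
     (\<forall>M\<in>S. \<forall>N\<in>S. M ** N \<in> S)"

definition is_module :: "(complex ^ 'v ^ 'v) set \<Rightarrow> (complex ^ 'v) set \<Rightarrow> bool" where
  "is_module S W \<longleftrightarrow> vec.subspace W \<and> (\<forall>s\<in>S. \<forall>w\<in>W. s *v w \<in> W)"

definition irreducible_module :: "(complex ^ 'v ^ 'v) set \<Rightarrow> (complex ^ 'v) set \<Rightarrow> bool" where
  "irreducible_module S W \<longleftrightarrow>
     is_module S W \<and> W \<noteq> {0} \<and> (\<forall>W'. is_module S W' \<and> W' \<subseteq> W \<longrightarrow> W' = {0} \<or> W' = W)"

text \<open>Maps between subspaces are total functions of which only the restriction to \<open>U\<close> matters.\<close>

definition linear_bijection ::
  "(complex ^ 'v \<Rightarrow> complex ^ 'v) \<Rightarrow> (complex ^ 'v) set \<Rightarrow> (complex ^ 'v) set \<Rightarrow> bool" where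
  "linear_bijection \<sigma> U W \<longleftrightarrow>
     bij_betw \<sigma> U W \<and>
     (\<forall>u\<in>U. \<forall>v\<in>U. \<sigma> (u + v) = \<sigma> u + \<sigma> v) \<and>
     (\<forall>c. \<forall>u\<in>U. \<sigma> (c *s u) = c *s \<sigma> u)"

definition isomorphic_modules ::
  "(complex ^ 'v ^ 'v) set \<Rightarrow> (complex ^ 'v) set \<Rightarrow> (complex ^ 'v) set \<Rightarrow> bool" where
  "isomorphic_modules S U W \<longleftrightarrow>
     (\<exists>\<sigma>. linear_bijection \<sigma> U W \<and> (\<forall>s\<in>S. \<forall>u\<in>U. \<sigma> (s *v u) = s *v \<sigma> u))"

section \<open>The subconstituent algebra and the quantum adjacency algebra\<close>

text \<open>Path-length distance; only meaningful when some walk joins the two vertices.\<close>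

definition graph_dist :: "'v pair_pre_digraph \<Rightarrow> 'v \<Rightarrow> 'v \<Rightarrow> nat" where
  "graph_dist \<Gamma> y z = (LEAST n. \<exists>p. pre_digraph.awalk (with_proj \<Gamma>) y p z \<and> length p = n)"

definition adj_matrix :: "'v::finite pair_pre_digraph \<Rightarrow> complex ^ 'v ^ 'v" where
  "adj_matrix \<Gamma> = (\<chi> y z. if (y, z) \<in> parcs \<Gamma> then 1 else 0)"

definition eccentricity :: "'v::finite pair_pre_digraph \<Rightarrow> 'v \<Rightarrow> nat" where
  "eccentricity \<Gamma> x = Max {graph_dist \<Gamma> x y | y. y \<in> pverts \<Gamma>}"

text \<open>The index of \<open>E\<^sub>i\<^sup>*\<close> is an integer, with the value \<open>0\<close> outside \<open>[0, D]\<close>, because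
  quasi-isomorphisms shift it by a possibly negative amount.\<close>

definition dual_idempotent :: "'v::finite pair_pre_digraph \<Rightarrow> 'v \<Rightarrow> int \<Rightarrow> complex ^ 'v ^ 'v" where
  "dual_idempotent \<Gamma> x i =
     (if 0 \<le> i \<and> i \<le> int (eccentricity \<Gamma> x)
      then \<chi> y z. if y = z \<and> int (graph_dist \<Gamma> x y) = i then 1 else 0
      else 0)"

definition subconstituent_algebra ::
  "'v::finite pair_pre_digraph \<Rightarrow> 'v \<Rightarrow> (complex ^ 'v ^ 'v) set" where
  "subconstituent_algebra \<Gamma> x =
     mat_subalgebra hull
       insert (adj_matrix \<Gamma>) (dual_idempotent \<Gamma> x ` {0..int (eccentricity \<Gamma> x)})"

definition lowering_matrix :: "'v::finite pair_pre_digraph \<Rightarrow> 'v \<Rightarrow> complex ^ 'v ^ 'v" where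
  "lowering_matrix \<Gamma> x =
     (\<Sum>i = 1..int (eccentricity \<Gamma> x).
        dual_idempotent \<Gamma> x (i - 1) ** adj_matrix \<Gamma> ** dual_idempotent \<Gamma> x i)"

definition flat_matrix :: "'v::finite pair_pre_digraph \<Rightarrow> 'v \<Rightarrow> complex ^ 'v ^ 'v" where
  "flat_matrix \<Gamma> x =
     (\<Sum>i = 0..int (eccentricity \<Gamma> x).
        dual_idempotent \<Gamma> x i ** adj_matrix \<Gamma> ** dual_idempotent \<Gamma> x i)"

definition raising_matrix :: "'v::finite pair_pre_digraph \<Rightarrow> 'v \<Rightarrow> complex ^ 'v ^ 'v" where
  "raising_matrix \<Gamma> x =
     (\<Sum>i = 0..int (eccentricity \<Gamma> x) - 1.
        dual_idempotent \<Gamma> x (i + 1) ** adj_matrix \<Gamma> ** dual_idempotent \<Gamma> x i)"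

definition quantum_adjacency_algebra ::
  "'v::finite pair_pre_digraph \<Rightarrow> 'v \<Rightarrow> (complex ^ 'v ^ 'v) set" where
  "quantum_adjacency_algebra \<Gamma> x =
     mat_subalgebra hull {lowering_matrix \<Gamma> x, flat_matrix \<Gamma> x, raising_matrix \<Gamma> x}"

section \<open>Quasi-isomorphisms\<close>

text \<open>Only meaningful for subspaces \<open>W\<close> other than \<open>{0}\<close>, where the set below is nonempty.\<close>

definition endpoint :: "'v::finite pair_pre_digraph \<Rightarrow> 'v \<Rightarrow> (complex ^ 'v) set \<Rightarrow> int" where
  "endpoint \<Gamma> x W =
     Min {i \<in> {0..int (eccentricity \<Gamma> x)}. (\<lambda>w. dual_idempotent \<Gamma> x i *v w) ` W \<noteq> {0}}"

definition quasi_isomorphism ::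
  "'v::finite pair_pre_digraph \<Rightarrow> 'v \<Rightarrow> (complex ^ 'v \<Rightarrow> complex ^ 'v) \<Rightarrow>
    (complex ^ 'v) set \<Rightarrow> (complex ^ 'v) set \<Rightarrow> bool" where
  "quasi_isomorphism \<Gamma> x \<sigma> U W \<longleftrightarrow>
     linear_bijection \<sigma> U W \<and>
     (\<forall>u\<in>U. \<sigma> (lowering_matrix \<Gamma> x *v u) = lowering_matrix \<Gamma> x *v \<sigma> u) \<and>
     (\<forall>u\<in>U. \<sigma> (flat_matrix \<Gamma> x *v u) = flat_matrix \<Gamma> x *v \<sigma> u) \<and>
     (\<forall>u\<in>U. \<sigma> (raising_matrix \<Gamma> x *v u) = raising_matrix \<Gamma> x *v \<sigma> u) \<and>
     (\<forall>i. \<forall>u\<in>U. \<sigma> (dual_idempotent \<Gamma> x i *v u) =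
        dual_idempotent \<Gamma> x (i + (endpoint \<Gamma> x W - endpoint \<Gamma> x U)) *v \<sigma> u)"

definition quasi_isomorphic ::
  "'v::finite pair_pre_digraph \<Rightarrow> 'v \<Rightarrow> (complex ^ 'v) set \<Rightarrow> (complex ^ 'v) set \<Rightarrow> bool" where
  "quasi_isomorphic \<Gamma> x U W \<longleftrightarrow> (\<exists>\<sigma>. quasi_isomorphism \<Gamma> x \<sigma> U W)"

end

theory Submission
  imports Defs
begin

text \<open>
  A quasi-isomorphism commutes with the generators \<open>L\<close>, \<open>F\<close>, \<open>R\<close> of \<open>Q\<close>, hence with all of \<open>Q\<close>;
  this settles one direction.

  For the other, an isomorphism \<open>\<sigma> : U \<rightarrow> W\<close> of \<open>Q\<close>-modules need not respect the gradings of
  \<open>U\<close> and \<open>W\<close> by the distance to \<open>x\<close>, and it is replaced by one of its homogeneous components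
  \<open>\<sigma>\<^sub>k = (\<Sum>i. E\<^sub>i\<^sub>+\<^sub>k\<^sup>* \<sigma> E\<^sub>i\<^sup>*)\<close>.
  Since \<open>L\<close>, \<open>F\<close>, \<open>R\<close> are homogeneous of degrees \<open>-1\<close>, \<open>0\<close>, \<open>1\<close>, each \<open>\<sigma>\<^sub>k\<close> commutes with them as
  \<open>\<sigma>\<close> does, and by construction it shifts the grading by \<open>k\<close>. A subspace is a \<open>T\<close>-module as soon
  as it is graded and stable under \<open>L\<close>, \<open>F\<close>, \<open>R\<close>, because \<open>A = L + F + R\<close>. So the kernel and the
  image of \<open>\<sigma>\<^sub>k\<close> are \<open>T\<close>-modules, and irreducibility over \<open>T\<close> makes \<open>\<sigma>\<^sub>k\<close> zero or bijective, as in
  Schur's lemma. The components sum to \<open>\<sigma> \<noteq> 0\<close>, so some \<open>\<sigma>\<^sub>k\<close> is bijective; shifting the grading by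
  \<open>k\<close> it carries the endpoint of \<open>U\<close> to that of \<open>W\<close>, which identifies \<open>k\<close> with the difference of
  the endpoints.
\<close>

section \<open>Modules over generated matrix algebras\<close>

lemma map_matrix_scale_vector: "map_matrix ((*) c) M *v w = c *s (M *v w)"
  for c :: complex
  by (simp add: vec_eq_iff matrix_vector_mult_def map_matrix_def sum_distrib_left mult.assoc)

lemma matrix_vector_mult_sum_left: "(\<Sum>i\<in>I. M i) *v w = (\<Sum>i\<in>I. M i *v w)"
  by (induction I rule: infinite_finite_induct) (auto simp: matrix_vector_mult_add_rdistrib)

lemma mat_subalgebra_stabilizer:
  assumes "vec.subspace W"
  shows "mat_subalgebra {M. \<forall>w\<in>W. M *v w \<in> W}"
  using assms
  by (auto simp: mat_subalgebra_def vec.subspace_def matrix_vector_mult_add_rdistrib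
      map_matrix_scale_vector simp flip: matrix_vector_mul_assoc)

lemma is_module_hull_iff:
  "is_module (mat_subalgebra hull S) W \<longleftrightarrow> vec.subspace W \<and> (\<forall>s\<in>S. \<forall>w\<in>W. s *v w \<in> W)"
proof safe
  assume W: "vec.subspace W" and "\<forall>s\<in>S. \<forall>w\<in>W. s *v w \<in> W"
  then have "mat_subalgebra hull S \<subseteq> {M. \<forall>w\<in>W. M *v w \<in> W}"
    by (intro hull_minimal mat_subalgebra_stabilizer) auto
  then show "is_module (mat_subalgebra hull S) W"
    using W by (auto simp: is_module_def)
qed (auto simp: is_module_def hull_inc)

text \<open>
  The elements that preserve \<open>U\<close> and commute with \<open>\<sigma>\<close> form a subalgebra; preservation is needed for
  products, since \<open>\<sigma>\<close> is constrained on \<open>U\<close> only.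
\<close>

lemma intertwines_hull:
  assumes \<sigma>: "linear_bijection \<sigma> U W" and U: "vec.subspace U"
    and gen: "\<And>s u. s \<in> S \<Longrightarrow> u \<in> U \<Longrightarrow> s *v u \<in> U \<and> \<sigma> (s *v u) = s *v \<sigma> u"
    and "s \<in> mat_subalgebra hull S" "u \<in> U"
  shows "\<sigma> (s *v u) = s *v \<sigma> u"
proof -
  let ?C = "{M. \<forall>u\<in>U. M *v u \<in> U \<and> \<sigma> (M *v u) = M *v \<sigma> u}"
  have "mat_subalgebra ?C"
    using \<sigma> U
    by (auto simp: mat_subalgebra_def linear_bijection_def vec.subspace_def
        matrix_vector_mult_add_rdistrib map_matrix_scale_vector simp flip: matrix_vector_mul_assoc)
  then have "mat_subalgebra hull S \<subseteq> ?C"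
    using gen by (intro hull_minimal) auto
  then show ?thesis
    using assms(4,5) by blast
qed

section \<open>The grading by the distance to the base vertex\<close>

locale rooted_graph = pair_graph \<Gamma> for \<Gamma> :: "'v::finite pair_pre_digraph" +
  fixes x :: 'v
  assumes pverts_UNIV: "pverts \<Gamma> = UNIV"
    and connected: "Digraph_Component.connected (with_proj \<Gamma>)"
begin

abbreviation d :: "'v \<Rightarrow> int" where "d y \<equiv> int (graph_dist \<Gamma> x y)"
abbreviation D :: int where "D \<equiv> int (eccentricity \<Gamma> x)"
abbreviation A where "A \<equiv> adj_matrix \<Gamma>"
abbreviation E where "E \<equiv> dual_idempotent \<Gamma> x"
abbreviation L where "L \<equiv> lowering_matrix \<Gamma> x"
abbreviation F where "F \<equiv> flat_matrix \<Gamma> x"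
abbreviation R where "R \<equiv> raising_matrix \<Gamma> x"
abbreviation T where "T \<equiv> subconstituent_algebra \<Gamma> x"
abbreviation Q where "Q \<equiv> quantum_adjacency_algebra \<Gamma> x"

lemma dist_le_eccentricity: "d y \<le> D"
proof -
  have "graph_dist \<Gamma> x y \<le> eccentricity \<Gamma> x"
    unfolding eccentricity_def by (rule Max_ge) (auto simp: pverts_UNIV full_SetCompr_eq)
  then show ?thesis by simp
qed

lemma shortest_walk: "\<exists>p. awalk x p y \<and> length p = graph_dist \<Gamma> x y"
proof -
  have "strongly_connected (with_proj \<Gamma>)"
    using connected by (intro symmetric_connected_imp_strongly_connected) auto
  then have "x \<rightarrow>\<^sup>*\<^bsub>with_proj \<Gamma>\<^esub> y"
    by (auto simp: strongly_connected_def pverts_UNIV)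
  then obtain p where "awalk x p y"
    by (auto simp: reachable_awalk)
  then have "\<exists>n p. awalk x p y \<and> length p = n"
    by blast
  then show ?thesis
    unfolding graph_dist_def by (rule LeastI_ex)
qed

lemma dist_arc:
  assumes "(y, z) \<in> parcs \<Gamma>"
  shows "d z \<le> d y + 1"
proof -
  obtain p where p: "awalk x p y" "length p = graph_dist \<Gamma> x y"
    using shortest_walk by blast
  have "awalk y [(y, z)] z"
    using assms by (simp add: awalk_Cons_iff awalk_Nil_iff pverts_UNIV)
  with p have "awalk x (p @ [(y, z)]) z"
    by (blast intro: awalk_appendI)
  then have "graph_dist \<Gamma> x z \<le> length (p @ [(y, z)])"
    unfolding graph_dist_def by (intro Least_le) blast
  then show ?thesis
    using p by simp
qed

lemma dist_adjacent:
  assumes "(y, z) \<in> parcs \<Gamma>"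
  shows "d y = d z - 1 \<or> d y = d z \<or> d y = d z + 1"
proof -
  have "(z, y) \<in> parcs \<Gamma>"
    using assms by (rule arcs_symmetric)
  then show ?thesis
    using dist_arc[OF assms] dist_arc[of z y] by linarith
qed

lemma dual_idempotent_entry: "E i $ y $ z = (if y = z \<and> d y = i then 1 else 0)"
  using dist_le_eccentricity[of y] by (auto simp: dual_idempotent_def)

lemma dual_idempotent_vector: "(E i *v w) $ y = (if d y = i then w $ y else 0)"
proof -
  have "(E i *v w) $ y = (\<Sum>z\<in>UNIV. if z = y then (if d y = i then w $ y else 0) else 0)"
    unfolding matrix_vector_mult_def vec_lambda_beta
    by (rule sum.cong) (auto simp: dual_idempotent_entry)
  then show ?thesis by simp
qed

lemma dual_idempotent_compose: "E i *v (E j *v w) = (if i = j then E i *v w else 0)"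
  by (auto simp: vec_eq_iff dual_idempotent_vector)

lemma dual_idempotent_outside: "i \<notin> {0..D} \<Longrightarrow> E i = 0"
  by (auto simp: dual_idempotent_def)

lemma sandwich_entry:
  "(E i ** A ** E j) $ y $ z = (if (y, z) \<in> parcs \<Gamma> \<and> d y = i \<and> d z = j then 1 else 0)"
proof -
  have EA: "(E i ** A) $ y $ v = (if (y, v) \<in> parcs \<Gamma> \<and> d y = i then 1 else 0)" for v
  proof -
    have "(E i ** A) $ y $ v =
        (\<Sum>u\<in>UNIV. if u = y then (if (y, v) \<in> parcs \<Gamma> \<and> d y = i then 1 else 0) else 0)"
      unfolding matrix_matrix_mult_def vec_lambda_beta
      by (rule sum.cong) (auto simp: dual_idempotent_entry adj_matrix_def)
    then show ?thesis by simp
  qed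
  have "(E i ** A ** E j) $ y $ z = (\<Sum>u\<in>UNIV. (E i ** A) $ y $ u * E j $ u $ z)"
    by (subst matrix_matrix_mult_def) simp
  also have "\<dots> = (\<Sum>u\<in>UNIV. if u = z
      then (if (y, z) \<in> parcs \<Gamma> \<and> d y = i \<and> d z = j then 1 else 0) else 0)"
    by (rule sum.cong) (auto simp: dual_idempotent_entry EA)
  finally show ?thesis by simp
qed

lemma lowering_entry: "L $ y $ z = (if (y, z) \<in> parcs \<Gamma> \<and> d y = d z - 1 then 1 else 0)"
proof -
  have "L $ y $ z = (\<Sum>i = 1..D. if i = d z then
      (if (y, z) \<in> parcs \<Gamma> \<and> d y = d z - 1 then 1 else 0) else 0)"
    unfolding lowering_matrix_def sum_component by (rule sum.cong) (auto simp: sandwich_entry)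
  then show ?thesis
    using dist_le_eccentricity[of z] by auto
qed

lemma flat_entry: "F $ y $ z = (if (y, z) \<in> parcs \<Gamma> \<and> d y = d z then 1 else 0)"
proof -
  have "F $ y $ z = (\<Sum>i = 0..D. if i = d z then
      (if (y, z) \<in> parcs \<Gamma> \<and> d y = d z then 1 else 0) else 0)"
    unfolding flat_matrix_def sum_component by (rule sum.cong) (auto simp: sandwich_entry)
  then show ?thesis
    using dist_le_eccentricity[of z] by auto
qed

lemma raising_entry: "R $ y $ z = (if (y, z) \<in> parcs \<Gamma> \<and> d y = d z + 1 then 1 else 0)"
proof -
  have "R $ y $ z = (\<Sum>i = 0..D - 1. if i = d z then
      (if (y, z) \<in> parcs \<Gamma> \<and> d y = d z + 1 then 1 else 0) else 0)"
    unfolding raising_matrix_def sum_component by (rule sum.cong) (auto simp: sandwich_entry)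
  then show ?thesis
    using dist_le_eccentricity[of y] by auto
qed

lemma adjacency_decomposition: "A = L + F + R"
  using dist_adjacent
  by (auto simp: vec_eq_iff adj_matrix_def lowering_entry flat_entry raising_entry)

lemma grading_decomposition: "(\<Sum>i\<in>{0..D}. E i *v w) = w"
proof -
  have "(\<Sum>i\<in>{0..D}. E i *v w) $ y = w $ y" for y
    using dist_le_eccentricity[of y] by (simp add: sum_component dual_idempotent_vector)
  then show ?thesis by (simp add: vec_eq_iff)
qed

lemma graded_component_nonzero:
  assumes "w \<noteq> 0"
  obtains i where "E i *v w \<noteq> 0"
  using assms grading_decomposition[of w] by (metis sum.neutral)

definition homogeneous :: "complex ^ 'v ^ 'v \<Rightarrow> int \<Rightarrow> bool" where
  "homogeneous M m \<longleftrightarrow> (\<forall>y z. M $ y $ z \<noteq> 0 \<longrightarrow> d y = d z + m)"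

lemma homogeneous_lowering: "homogeneous L (- 1)"
  and homogeneous_flat: "homogeneous F 0"
  and homogeneous_raising: "homogeneous R 1"
  by (auto simp: homogeneous_def lowering_entry flat_entry raising_entry)

lemma homogeneous_shift:
  assumes "homogeneous M m"
  shows "E i *v (M *v w) = M *v (E (i - m) *v w)"
proof -
  have "(E i *v (M *v w)) $ y = (M *v (E (i - m) *v w)) $ y" for y
  proof -
    have "(if d y = i then M $ y $ z * w $ z else 0) =
        M $ y $ z * (if d z = i - m then w $ z else 0)" for z
    proof -
      have "M $ y $ z = 0 \<or> d y = d z + m"
        using assms unfolding homogeneous_def by blast
      then show ?thesis by auto
    qed
    then have "(\<Sum>z\<in>UNIV. if d y = i then M $ y $ z * w $ z else 0) =
        (M *v (E (i - m) *v w)) $ y"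
      by (simp add: matrix_vector_mult_def[of M] dual_idempotent_vector)
    then show ?thesis
      by (cases "d y = i") (simp_all add: dual_idempotent_vector matrix_vector_mult_def[of M w])
  qed
  then show ?thesis by (simp add: vec_eq_iff)
qed

text \<open>
  Trading the generator \<open>A\<close> for \<open>L\<close>, \<open>F\<close>, \<open>R\<close> is what lets \<open>T\<close>-modules be recognised from maps that
  know nothing of \<open>T\<close> but its homogeneous parts. The idempotents vanish in degrees outside
  \<open>[0, D]\<close>, so stability may be asked for all integers, which suits shifted gradings.
\<close>

lemma is_module_T_iff:
  "is_module T W \<longleftrightarrow> vec.subspace W \<and>
     (\<forall>w\<in>W. L *v w \<in> W \<and> F *v w \<in> W \<and> R *v w \<in> W \<and> (\<forall>i. E i *v w \<in> W))"
    (is "?l \<longleftrightarrow> ?r")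
proof
  assume ?l
  then have W: "vec.subspace W" and A: "\<And>w. w \<in> W \<Longrightarrow> A *v w \<in> W"
    and E_range: "\<And>i w. w \<in> W \<Longrightarrow> i \<in> {0..D} \<Longrightarrow> E i *v w \<in> W"
    by (auto simp: subconstituent_algebra_def is_module_hull_iff)
  have E: "E i *v w \<in> W" if "w \<in> W" for i w
    using E_range[of w i] that vec.subspace_0[OF W] dual_idempotent_outside[of i]
    by (cases "i \<in> {0..D}") auto
  have "(\<Sum>i\<in>I. E (f i) ** A ** E i) *v w \<in> W" if "w \<in> W" for f and I :: "int set" and w
    unfolding matrix_vector_mult_sum_left using that
    by (auto intro!: vec.subspace_sum[OF W] A E simp flip: matrix_vector_mul_assoc)
  note this[of _ "\<lambda>i. i - 1"] this[of _ "\<lambda>i. i"] this[of _ "\<lambda>i. i + 1"]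
  with W E show ?r
    unfolding lowering_matrix_def flat_matrix_def raising_matrix_def by blast
next
  assume ?r
  then show ?l
    by (auto simp: subconstituent_algebra_def is_module_hull_iff adjacency_decomposition
        matrix_vector_mult_add_rdistrib vec.subspace_add)
qed

section \<open>Homogeneous intertwiners between modules\<close>

definition intertwiner ::
  "int \<Rightarrow> (complex ^ 'v \<Rightarrow> complex ^ 'v) \<Rightarrow> (complex ^ 'v) set \<Rightarrow> (complex ^ 'v) set \<Rightarrow> bool" where
  "intertwiner k \<tau> U W \<longleftrightarrow>
     \<tau> ` U \<subseteq> W \<and>
     (\<forall>u\<in>U. \<forall>v\<in>U. \<tau> (u + v) = \<tau> u + \<tau> v) \<and>
     (\<forall>c. \<forall>u\<in>U. \<tau> (c *s u) = c *s \<tau> u) \<and>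
     (\<forall>u\<in>U. \<tau> (L *v u) = L *v \<tau> u \<and> \<tau> (F *v u) = F *v \<tau> u \<and> \<tau> (R *v u) = R *v \<tau> u) \<and>
     (\<forall>i. \<forall>u\<in>U. \<tau> (E i *v u) = E (i + k) *v \<tau> u)"

lemma intertwiner_kernel:
  assumes "intertwiner k \<tau> U W" "is_module T U"
  shows "is_module T {u\<in>U. \<tau> u = 0}"
proof -
  have U: "vec.subspace U"
    using assms(2) by (simp add: is_module_T_iff)
  have "\<tau> (0 *s 0) = 0 *s \<tau> 0"
    using assms(1) vec.subspace_0[OF U] unfolding intertwiner_def by blast
  then have "\<tau> 0 = 0"
    by simp
  then show ?thesis
    using assms by (auto simp: is_module_T_iff intertwiner_def vec.subspace_def)
qed

lemma intertwiner_image: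
  assumes \<tau>: "intertwiner k \<tau> U W" and U: "is_module T U"
  shows "is_module T (\<tau> ` U)"
proof -
  have sub: "vec.subspace U"
    using U by (simp add: is_module_T_iff)
  have "\<tau> (0 *s 0) = 0 *s \<tau> 0"
    using \<tau> vec.subspace_0[OF sub] unfolding intertwiner_def by blast
  then have "0 \<in> \<tau> ` U"
    using vec.subspace_0[OF sub] by force
  moreover have "\<tau> u + \<tau> v \<in> \<tau> ` U" "c *s \<tau> u \<in> \<tau> ` U" if "u \<in> U" "v \<in> U" for u v c
  proof -
    have "\<tau> u + \<tau> v = \<tau> (u + v)" "c *s \<tau> u = \<tau> (c *s u)"
      using \<tau> that by (auto simp: intertwiner_def)
    then show "\<tau> u + \<tau> v \<in> \<tau> ` U" "c *s \<tau> u \<in> \<tau> ` U"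
      using that sub by (auto simp: vec.subspace_add vec.subspace_scale)
  qed
  moreover have "L *v \<tau> u \<in> \<tau> ` U \<and> F *v \<tau> u \<in> \<tau> ` U \<and> R *v \<tau> u \<in> \<tau> ` U \<and> E i *v \<tau> u \<in> \<tau> ` U"
    if "u \<in> U" for u i
  proof -
    have "E i *v \<tau> u = \<tau> (E (i - k) *v u)" "L *v \<tau> u = \<tau> (L *v u)"
      "F *v \<tau> u = \<tau> (F *v u)" "R *v \<tau> u = \<tau> (R *v u)"
      using \<tau> that by (auto simp: intertwiner_def)
    then show ?thesis
      using U that by (auto simp: is_module_T_iff)
  qed
  ultimately show ?thesis
    unfolding is_module_T_iff vec.subspace_def by blast
qed

text \<open>
  Schur's lemma for maps that only commute with \<open>L\<close>, \<open>F\<close>, \<open>R\<close>: a shift of the grading still maps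
  graded subspaces to graded subspaces, so kernel and image are modules over all of \<open>T\<close>.
\<close>

lemma intertwiner_bijective:
  assumes \<tau>: "intertwiner k \<tau> U W"
    and U: "irreducible_module T U" and W: "irreducible_module T W"
    and nz: "u \<in> U" "\<tau> u \<noteq> 0"
  shows "linear_bijection \<tau> U W"
proof -
  have mod: "is_module T U"
    using U by (simp add: irreducible_module_def)
  have "is_module T {u\<in>U. \<tau> u = 0}" "is_module T (\<tau> ` U)"
    using intertwiner_kernel intertwiner_image \<tau> mod by blast+
  moreover have "\<tau> ` U \<subseteq> W"
    using \<tau> by (simp add: intertwiner_def)
  ultimately have "{u\<in>U. \<tau> u = 0} = {0} \<or> {u\<in>U. \<tau> u = 0} = U" "\<tau> ` U = {0} \<or> \<tau> ` U = W"
    using U W unfolding irreducible_module_def by blast+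
  then have ker: "{u\<in>U. \<tau> u = 0} = {0}" and img: "\<tau> ` U = W"
    using nz by auto
  have sub: "vec.subspace U"
    using mod by (simp add: is_module_T_iff)
  have "inj_on \<tau> U"
  proof (rule inj_onI)
    fix a b assume ab: "a \<in> U" "b \<in> U" "\<tau> a = \<tau> b"
    have neg: "(- 1) *s b \<in> U"
      using ab sub by (simp only: vec.subspace_scale)
    then have "\<tau> (a + (- 1) *s b) = \<tau> a + \<tau> ((- 1) *s b)"
      using \<tau> ab unfolding intertwiner_def by blast
    also have "\<tau> ((- 1) *s b) = (- 1) *s \<tau> b"
      using \<tau> ab unfolding intertwiner_def by blast
    finally have "a + (- 1) *s b \<in> {u\<in>U. \<tau> u = 0}"
      using ab neg sub vec.subspace_add[OF sub ab(1) neg] by (simp add: vec_eq_iff)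
    then have "a + (- 1) *s b = 0"
      using ker by blast
    then show "a = b"
      by (simp add: vec_eq_iff)
  qed
  then show ?thesis
    using \<tau> img by (auto simp: linear_bijection_def intertwiner_def bij_betw_def)
qed

text \<open>
  A bijective intertwiner restricts to bijections from degree \<open>i\<close> of \<open>U\<close> to degree \<open>i + k\<close> of \<open>W\<close>, so
  the set of degrees that occur in \<open>W\<close> is a translate of the one for \<open>U\<close>.
\<close>

lemma intertwiner_endpoint:
  assumes \<tau>: "intertwiner k \<tau> U W" and bij: "linear_bijection \<tau> U W"
    and U: "is_module T U" "U \<noteq> {0}"
  shows "endpoint \<Gamma> x W = endpoint \<Gamma> x U + k"
proof -
  let ?S = "\<lambda>W. {i \<in> {0..D}. (\<lambda>w. E i *v w) ` W \<noteq> {0}}"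
  have sub: "vec.subspace U"
    using U by (simp add: is_module_T_iff)
  have ker: "{u\<in>U. \<tau> u = 0} = {0}"
  proof -
    have "vec.subspace {u\<in>U. \<tau> u = 0}"
      using intertwiner_kernel[OF \<tau> U(1)] by (simp add: is_module_T_iff)
    from vec.subspace_0[OF this] have zero: "0 \<in> U" "\<tau> 0 = 0"
      by auto
    have inj: "inj_on \<tau> U"
      using bij by (auto simp: linear_bijection_def bij_betw_def)
    have "u = 0" if "u \<in> U" "\<tau> u = 0" for u
      by (rule inj_onD[OF inj _ that(1) zero(1)]) (simp only: that(2) zero(2))
    with zero show ?thesis
      by blast
  qed
  have img: "W = \<tau> ` U"
    using bij by (auto simp: linear_bijection_def bij_betw_def)
  have zero: "0 \<in> U" "0 \<in> W"
    using sub ker img by (force simp: vec.subspace_0)+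
  have in_S: "i \<in> ?S V \<longleftrightarrow> (\<exists>v\<in>V. E i *v v \<noteq> 0)" if "0 \<in> V" for i V
  proof -
    have "0 \<in> (\<lambda>w. E i *v w) ` V"
      using that by force
    then have "(\<lambda>w. E i *v w) ` V \<noteq> {0} \<longleftrightarrow> (\<exists>v\<in>V. E i *v v \<noteq> 0)"
      by blast
    moreover have "i \<in> {0..D}" if "E i *v v \<noteq> 0" for v
      using that dual_idempotent_outside[of i] by (cases "i \<in> {0..D}") auto
    ultimately show ?thesis by blast
  qed
  have shift: "E (i + k) *v \<tau> u \<noteq> 0 \<longleftrightarrow> E i *v u \<noteq> 0" if "u \<in> U" for i u
  proof -
    have "E (i + k) *v \<tau> u = \<tau> (E i *v u)" "E i *v u \<in> U"
      using \<tau> U that by (auto simp: intertwiner_def is_module_T_iff)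
    then show ?thesis
      using ker by auto
  qed
  have mem: "i + k \<in> ?S W \<longleftrightarrow> i \<in> ?S U" for i
    unfolding in_S[OF zero(1)] in_S[OF zero(2)] unfolding img using shift by blast
  have "?S W = (\<lambda>i. i + k) ` ?S U"
  proof (intro equalityI subsetI)
    fix j assume "j \<in> ?S W"
    then have "j - k \<in> ?S U"
      using mem[of "j - k"] by simp
    then have "(j - k) + k \<in> (\<lambda>i. i + k) ` ?S U"
      by (rule imageI)
    then show "j \<in> (\<lambda>i. i + k) ` ?S U"
      by simp
  qed (use mem in blast)
  moreover have "?S U \<noteq> {}"
  proof -
    obtain u where "u \<in> U" "u \<noteq> 0"
      using U zero by blast
    moreover obtain i where "E i *v u \<noteq> 0"
      using graded_component_nonzero[OF \<open>u \<noteq> 0\<close>] .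
    ultimately have "i \<in> ?S U"
      unfolding in_S[OF zero(1)] by blast
    then show ?thesis
      by blast
  qed
  moreover have "finite (?S U)"
    by (rule finite_subset[of _ "{0..D}"]) auto
  ultimately show ?thesis
    using mono_Min_commute[of "\<lambda>i. i + k" "?S U"] by (simp add: endpoint_def mono_def)
qed

section \<open>Homogeneous components of an isomorphism of \<open>Q\<close>-modules\<close>

definition component ::
  "(complex ^ 'v \<Rightarrow> complex ^ 'v) \<Rightarrow> int \<Rightarrow> complex ^ 'v \<Rightarrow> complex ^ 'v" where
  "component \<sigma> k u = (\<Sum>i\<in>{0..D}. E (i + k) *v \<sigma> (E i *v u))"

text \<open>
  At a vertex \<open>y\<close> only the summand that lands in degree \<open>d y\<close> is visible. The assumption \<open>\<sigma> 0 = 0\<close>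
  makes this hold even if \<open>d y - k\<close> is not a degree, when that summand does not occur.
\<close>

lemma component_entry:
  assumes "\<sigma> 0 = 0"
  shows "component \<sigma> k u $ y = \<sigma> (E (d y - k) *v u) $ y"
proof -
  have "component \<sigma> k u $ y =
      (\<Sum>i\<in>{0..D}. if i = d y - k then \<sigma> (E (d y - k) *v u) $ y else 0)"
    unfolding component_def sum_component by (rule sum.cong) (auto simp: dual_idempotent_vector)
  also have "\<dots> = \<sigma> (E (d y - k) *v u) $ y"
    using dual_idempotent_outside[of "d y - k"] assms by (auto simp: sum.delta)
  finally show ?thesis .
qed

text \<open>
  The component \<open>\<sigma>\<^sub>k\<close> at \<open>y\<close> reads \<open>\<sigma>\<close> on degree \<open>d y - k\<close>. Moving \<open>M\<close> past the idempotent and \<open>\<sigma>\<close>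
  lowers this degree by \<open>m\<close>, which is what the vertices \<open>z\<close> with \<open>M $ y $ z \<noteq> 0\<close> require, since
  \<open>d z = d y - m\<close>.
\<close>

lemma component_commutes:
  assumes \<sigma>0: "\<sigma> 0 = 0" and M: "homogeneous M m"
    and comm: "\<And>i. \<sigma> (M *v (E i *v u)) = M *v \<sigma> (E i *v u)"
  shows "component \<sigma> k (M *v u) = M *v component \<sigma> k u"
proof -
  have "component \<sigma> k (M *v u) $ y = (M *v component \<sigma> k u) $ y" for y
  proof -
    have "component \<sigma> k (M *v u) $ y = (M *v \<sigma> (E (d y - k - m) *v u)) $ y"
      by (simp add: component_entry[of \<sigma>, OF \<sigma>0] homogeneous_shift[OF M] comm)
    also have "\<dots> = (\<Sum>z\<in>UNIV. M $ y $ z * \<sigma> (E (d z - k) *v u) $ z)"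
      unfolding matrix_vector_mult_def[of M] vec_lambda_beta
    proof (rule sum.cong)
      fix z
      have "M $ y $ z = 0 \<or> d y = d z + m"
        using M unfolding homogeneous_def by blast
      then show "M $ y $ z * \<sigma> (E (d y - k - m) *v u) $ z =
          M $ y $ z * \<sigma> (E (d z - k) *v u) $ z"
      proof
        assume "d y = d z + m"
        then have "d y - k - m = d z - k" by linarith
        then show ?thesis by (simp only:)
      qed simp
    qed simp
    finally show ?thesis
      by (simp add: matrix_vector_mult_def component_entry[of \<sigma>, OF \<sigma>0])
  qed
  then show ?thesis by (simp add: vec_eq_iff)
qed

lemma generators_in_Q: "L \<in> Q" "F \<in> Q" "R \<in> Q"
  by (auto simp: quantum_adjacency_algebra_def hull_inc)

lemma component_intertwiner:
  assumes \<sigma>: "linear_bijection \<sigma> U W" "\<And>s u. s \<in> Q \<Longrightarrow> u \<in> U \<Longrightarrow> \<sigma> (s *v u) = s *v \<sigma> u"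
    and \<sigma>0: "\<sigma> 0 = 0"
    and U: "is_module T U" and W: "is_module T W"
  shows "intertwiner k (component \<sigma> k) U W"
proof -
  have E: "E i *v u \<in> U" if "u \<in> U" for i u
    using U that by (simp add: is_module_T_iff)
  have add: "component \<sigma> k (u + v) = component \<sigma> k u + component \<sigma> k v"
    if "u \<in> U" "v \<in> U" for u v
    using \<sigma>(1) that E
    by (auto simp: linear_bijection_def component_entry[of \<sigma>, OF \<sigma>0] vec_eq_iff
        matrix_vector_right_distrib)
  have scale: "component \<sigma> k (c *s u) = c *s component \<sigma> k u" if "u \<in> U" for c u
    using \<sigma>(1) that E
    by (auto simp: linear_bijection_def component_entry[of \<sigma>, OF \<sigma>0] vec_eq_iff
        vector_scalar_commute)
  have range: "component \<sigma> k u \<in> W" if "u \<in> U" for u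
  proof -
    have "\<sigma> (E i *v u) \<in> W" for i
      using \<sigma>(1) E[OF that] by (auto simp: linear_bijection_def bij_betw_def)
    then show ?thesis
      using W unfolding component_def is_module_T_iff by (blast intro: vec.subspace_sum)
  qed
  have grade: "component \<sigma> k (E i *v u) = E (i + k) *v component \<sigma> k u" for i u
    by (auto simp: vec_eq_iff component_entry[of \<sigma>, OF \<sigma>0] dual_idempotent_vector
        dual_idempotent_compose \<sigma>0)
  have comm: "component \<sigma> k (M *v u) = M *v component \<sigma> k u"
    if "u \<in> U" "M \<in> Q" "homogeneous M m" for M m u
    using that E \<sigma>(2) by (intro component_commutes[of \<sigma>, OF \<sigma>0]) auto
  show ?thesis
    unfolding intertwiner_def
    using add scale range grade comm[OF _ generators_in_Q(1) homogeneous_lowering]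
      comm[OF _ generators_in_Q(2) homogeneous_flat]
      comm[OF _ generators_in_Q(3) homogeneous_raising] by blast
qed

text \<open>
  If \<open>\<sigma>\<close> does not annihilate the degree \<open>i\<close> part of a vector and its value there has a nonzero entry
  at \<open>y\<close>, then the component of degree \<open>d y - i\<close> sees that entry.
\<close>

lemma component_nonzero:
  assumes \<sigma>: "linear_bijection \<sigma> U W" and \<sigma>0: "\<sigma> 0 = 0"
    and U: "is_module T U" "U \<noteq> {0}"
  obtains k u where "u \<in> U" "component \<sigma> k u \<noteq> 0"
proof -
  have zero: "0 \<in> U"
    using U by (auto simp: is_module_T_iff vec.subspace_0)
  obtain u where u: "u \<in> U" "u \<noteq> 0"
    using U zero by blast
  obtain i where i: "E i *v u \<noteq> 0"
    using u graded_component_nonzero by blast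
  have Eu: "E i *v u \<in> U"
    using U u by (auto simp: is_module_T_iff)
  have "inj_on \<sigma> U"
    using \<sigma> by (auto simp: linear_bijection_def bij_betw_def)
  then have "\<sigma> (E i *v u) \<noteq> 0"
    using i Eu zero \<sigma>0 by (metis inj_onD)
  then obtain y where y: "\<sigma> (E i *v u) $ y \<noteq> 0"
    by (auto simp: vec_eq_iff)
  have "component \<sigma> (d y - i) (E i *v u) $ y \<noteq> 0"
    using y by (simp add: component_entry[of \<sigma>, OF \<sigma>0] dual_idempotent_compose)
  then have "component \<sigma> (d y - i) (E i *v u) \<noteq> 0"
    by auto
  with Eu that show ?thesis by blast
qed

lemma Q_isomorphic_imp_quasi_isomorphic:
  assumes U: "irreducible_module T U" and W: "irreducible_module T W"
    and iso: "isomorphic_modules Q U W"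
  shows "quasi_isomorphic \<Gamma> x U W"
proof -
  obtain \<sigma> where \<sigma>: "linear_bijection \<sigma> U W"
      "\<And>s u. s \<in> Q \<Longrightarrow> u \<in> U \<Longrightarrow> \<sigma> (s *v u) = s *v \<sigma> u"
    using iso by (auto simp: isomorphic_modules_def)
  have mod: "is_module T U" "is_module T W" "U \<noteq> {0}"
    using U W by (auto simp: irreducible_module_def)
  have "\<sigma> (0 *s 0) = 0 *s \<sigma> 0"
    using \<sigma>(1) mod(1) unfolding linear_bijection_def is_module_T_iff
    by (blast dest: vec.subspace_0)
  then have \<sigma>0: "\<sigma> 0 = 0"
    by simp
  obtain k u where u: "u \<in> U" "component \<sigma> k u \<noteq> 0"
    using component_nonzero[OF \<sigma>(1) \<sigma>0 mod(1,3)] .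
  have \<tau>: "intertwiner k (component \<sigma> k) U W"
    using component_intertwiner[OF \<sigma> \<sigma>0 mod(1,2)] .
  have bij: "linear_bijection (component \<sigma> k) U W"
    using intertwiner_bijective[OF \<tau> U W u] .
  have "endpoint \<Gamma> x W - endpoint \<Gamma> x U = k"
    using intertwiner_endpoint[OF \<tau> bij mod(1,3)] by simp
  then have "quasi_isomorphism \<Gamma> x (component \<sigma> k) U W"
    using \<tau> bij by (simp add: quasi_isomorphism_def intertwiner_def)
  then show ?thesis
    by (auto simp: quasi_isomorphic_def)
qed

lemma quasi_isomorphic_imp_Q_isomorphic:
  assumes U: "is_module T U" and quasi: "quasi_isomorphic \<Gamma> x U W"
  shows "isomorphic_modules Q U W"
proof -
  obtain \<sigma> where \<sigma>: "quasi_isomorphism \<Gamma> x \<sigma> U W"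
    using quasi by (auto simp: quasi_isomorphic_def)
  then have bij: "linear_bijection \<sigma> U W"
    by (simp add: quasi_isomorphism_def)
  have "\<sigma> (s *v u) = s *v \<sigma> u" if "s \<in> Q" "u \<in> U" for s u
    using that(1)[unfolded quantum_adjacency_algebra_def] that(2)
    by (rule intertwines_hull[OF bij, rotated 2])
      (use U \<sigma> in \<open>auto simp: is_module_T_iff quasi_isomorphism_def\<close>)
  with bij show ?thesis
    by (auto simp: isomorphic_modules_def)
qed

end

theorem corollary8p7:
  fixes \<Gamma> :: "'v::finite pair_pre_digraph" and x :: 'v and U W :: "(complex ^ 'v) set"
  assumes "pair_graph \<Gamma>"
    and "pverts \<Gamma> = UNIV"
    and "Digraph_Component.connected (with_proj \<Gamma>)"
    and "irreducible_module (subconstituent_algebra \<Gamma> x) U"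
    and "irreducible_module (subconstituent_algebra \<Gamma> x) W"
  shows "isomorphic_modules (quantum_adjacency_algebra \<Gamma> x) U W \<longleftrightarrow> quasi_isomorphic \<Gamma> x U W"
proof -
  interpret rooted_graph \<Gamma> x
    using assms(1-3) by (simp add: rooted_graph_def rooted_graph_axioms_def)
  show ?thesis
    using Q_isomorphic_imp_quasi_isomorphic[OF assms(4,5)] quasi_isomorphic_imp_Q_isomorphic
      assms(4) by (auto simp: irreducible_module_def)
qed

end
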